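(* Let $n\ge 1$, let $A\in\mathcal{M}_n(\mathbb{C})$ satisfy $w(A)=\|A\|$, and let $m\ge 1$ be an integer. Then $w(A^{\circ m})=w(A)^m$ if and only if $A^{\otimes m}$ has an eigenvector lying in $\mathrm{span}_{\mathbb{C}}\{\mathbf{e}_1^{\otimes m},\dots,\mathbf{e}_n^{\otimes m}\}$ whose eigenvalue $\lambda$ satisfies $|\lambda|=\|A\|^m$. Moreover, if this holds, then $w(A^{\circ m'})=w(A)^{m'}$ for all integers $1\le m'\le m$.
   Context: For a complex square matrix $A$, $\|A\|$ is the spectral norm (operator norm with respect to the Euclidean norm) and $w(A)=\sup\{|\langle Ax,x\rangle| : \|x\|=1\}$ is the numerical radius. $A^{\circ m}=[a_{ij}^m]$ is the entrywise (Schur/Hadamard) $m$-th power of $A=[a_{ij}]$, and $A^{\otimes m}$ is the $m$-fold Kronecker product of $A$ with itself, acting on $(\mathbb{C}^n)^{\otimes m}\cong\mathbb{C}^{n^m}$. $\mathbf{e}_1,\dots,\mathbf{e}_n$ is the standard basis of $\mathbb{C}^n$ and $\mathbf{e}_j^{\otimes m}$ is the $m$-fold tensor power. *)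

theory Defs
  imports
    "HOL-Analysis.L2_Norm"
    "Jordan_Normal_Form.Char_Poly"
    "Jordan_Normal_Form.VS_Connect"
    "Jordan_Normal_Form.Conjugate"
begin

text \<open>
  Vectors and matrices are those of \<open>Jordan_Normal_Form\<close>: dimensions are natural numbers carried by
  the values, and indices start at 0, so the standard basis of \<open>\<complex>\<^sup>n\<close> is
  \<open>unit_vec n 0, \<dots>, unit_vec n (n - 1)\<close>.
\<close>

definition l2_norm_vec :: "complex vec \<Rightarrow> real" where
  "l2_norm_vec v = L2_set (\<lambda>i. cmod (v $ i)) {..<dim_vec v}"

text \<open>
  The suprema below are taken in \<open>real\<close>. They are meaningful for square matrices of size at least 1,
  where the sets are nonempty and bounded.
\<close>

definition spectral_norm :: "complex mat \<Rightarrow> real" where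
  "spectral_norm A =
     Sup {l2_norm_vec (A *\<^sub>v x) | x. x \<in> carrier_vec (dim_col A) \<and> l2_norm_vec x = 1}"

text \<open>\<open>u \<bullet>c v\<close> is the inner product, conjugate-linear in its second argument.\<close>

definition numerical_radius :: "complex mat \<Rightarrow> real" where
  "numerical_radius A =
     Sup {cmod ((A *\<^sub>v x) \<bullet>c x) | x. x \<in> carrier_vec (dim_col A) \<and> l2_norm_vec x = 1}"

definition hadamard_power :: "complex mat \<Rightarrow> nat \<Rightarrow> complex mat" where
  "hadamard_power A m = map_mat (\<lambda>a. a ^ m) A"

text \<open>
  \<open>\<complex>\<^sup>p \<otimes> \<complex>\<^sup>q\<close> is identified with \<open>\<complex>\<^sup>p\<^sup>q\<close> by sending the index pair \<open>(i, j)\<close> to \<open>i * q + j\<close>, both for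
  vectors and for matrices.
\<close>

definition kronecker_vec :: "complex vec \<Rightarrow> complex vec \<Rightarrow> complex vec" where
  "kronecker_vec u v = vec (dim_vec u * dim_vec v)
     (\<lambda>i. u $ (i div dim_vec v) * v $ (i mod dim_vec v))"

definition kronecker_mat :: "complex mat \<Rightarrow> complex mat \<Rightarrow> complex mat" where
  "kronecker_mat A B = mat (dim_row A * dim_row B) (dim_col A * dim_col B)
     (\<lambda>(i, j). A $$ (i div dim_row B, j div dim_col B) * B $$ (i mod dim_row B, j mod dim_col B))"

primrec kronecker_vec_power :: "complex vec \<Rightarrow> nat \<Rightarrow> complex vec" where
  "kronecker_vec_power v 0 = vec 1 (\<lambda>_. 1)"
| "kronecker_vec_power v (Suc m) = kronecker_vec v (kronecker_vec_power v m)"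

primrec kronecker_mat_power :: "complex mat \<Rightarrow> nat \<Rightarrow> complex mat" where
  "kronecker_mat_power A 0 = 1\<^sub>m 1"
| "kronecker_mat_power A (Suc m) = kronecker_mat A (kronecker_mat_power A m)"

lemma kronecker_vec_power_carrier:
  "v \<in> carrier_vec n \<Longrightarrow> kronecker_vec_power v m \<in> carrier_vec (n ^ m)"
  by (induction m) (auto simp: kronecker_vec_def)

lemma kronecker_mat_power_carrier:
  "A \<in> carrier_mat n n \<Longrightarrow> kronecker_mat_power A m \<in> carrier_mat (n ^ m) (n ^ m)"
  by (induction m) (auto simp: kronecker_mat_def)

abbreviation span_vec :: "nat \<Rightarrow> complex vec set \<Rightarrow> complex vec set" where
  "span_vec d \<equiv> LinearCombinations.module.span class_ring (module_vec TYPE(complex) d)"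

end

theory Submission
  imports Defs "HOL-Analysis.Function_Topology"
begin

text \<open>
  Let \<open>N = \<parallel>A\<parallel>\<close>. The vectors \<open>e\<^sub>j \<otimes> \<dots> \<otimes> e\<^sub>j\<close> are orthonormal, and the Hadamard power of \<open>A\<close> is the
  compression of the Kronecker power \<open>M = A \<otimes> \<dots> \<otimes> A\<close> to their span
  (\<open>hadamard_power_compression\<close>). As \<open>M\<close> has norm at most \<open>N\<^sup>m\<close>
  (\<open>l2_norm_kronecker_mat_power_le\<close>), the numerical radius of the Hadamard power is at most \<open>N\<^sup>m\<close>.
  By compactness some unit vector attains it, so it equals \<open>N\<^sup>m\<close> exactly when some unit vector \<open>v\<close>
  of the span has \<open>|\<langle>M v, v\<rangle>| = N\<^sup>m\<close>. That is equality in the Cauchy--Schwarz inequality, and it says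
  that \<open>v\<close> is an eigenvector of \<open>M\<close> with an eigenvalue of modulus \<open>N\<^sup>m\<close>. This is the equivalence,
  \<open>hadamard_power_extremal_iff\<close>.

  For the passage from \<open>m\<close> to smaller exponents only \<open>m \<ge> 3\<close> needs an argument: the exponent \<open>1\<close>
  is the hypothesis \<open>w(A) = N\<close> itself. Rows and columns of \<open>A\<close> have Euclidean norm at most \<open>N\<close>, so
  for a unit vector \<open>x\<close>
  \<open>|\<Sum> a\<^sub>k\<^sub>j\<^sup>m x\<^sub>j cnj x\<^sub>k| \<le> N\<^sup>m\<^sup>-\<^sup>2 \<Sum> |a\<^sub>k\<^sub>j|\<^sup>2 |x\<^sub>j| |x\<^sub>k| \<le> N\<^sup>m\<^sup>-\<^sup>2 \<Sum> |a\<^sub>k\<^sub>j|\<^sup>2 (|x\<^sub>j|\<^sup>2 + |x\<^sub>k|\<^sup>2) / 2 \<le> N\<^sup>m\<close>.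
  If \<open>N > 0\<close> and the left-hand side reaches \<open>N\<^sup>m\<close>, all steps are equalities, which forces every row indexed by the
  support of \<open>x\<close> to have exactly one nonzero entry, of modulus \<open>N\<close> and in a column of the support
  again (\<open>extremal_row_has_single_entry\<close>). Following these entries from row to column one runs into
  a cycle. On the coordinates of a cycle every Hadamard power with exponent \<open>m' \<ge> 1\<close> acts as a
  weighted cyclic shift with weights of modulus \<open>N\<^sup>m\<^sup>'\<close>, and an eigenvector of the shift attains the
  bound \<open>N\<^sup>m\<^sup>'\<close> (\<open>quadratic_form_on_cycle\<close>).
\<close>

section \<open>Coordinates, inner product and norm\<close>

lemma mult_mat_vec_nth:
  assumes "A \<in> carrier_mat p q" "v \<in> carrier_vec q" "i < p"
  shows "(A *\<^sub>v v) $ i = (\<Sum>j<q. A $$ (i, j) * v $ j)"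
  using assms by (auto simp: scalar_prod_def atLeast0LessThan intro!: sum.cong)

lemma inner_prod_sum:
  fixes u v :: "complex vec"
  assumes "u \<in> carrier_vec n" "v \<in> carrier_vec n"
  shows "u \<bullet>c v = (\<Sum>i<n. u $ i * cnj (v $ i))"
  using assms by (auto simp: scalar_prod_def atLeast0LessThan intro!: sum.cong)

lemma l2_norm_vec_nonneg [simp]: "0 \<le> l2_norm_vec v"
  by (simp add: l2_norm_vec_def)

lemma l2_norm_vec_square:
  assumes "v \<in> carrier_vec n"
  shows "(l2_norm_vec v)\<^sup>2 = (\<Sum>i<n. (cmod (v $ i))\<^sup>2)"
  using assms by (auto simp: l2_norm_vec_def L2_set_def sum_nonneg)

lemma l2_norm_vec_eq_0_iff:
  assumes "v \<in> carrier_vec n"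
  shows "l2_norm_vec v = 0 \<longleftrightarrow> v = 0\<^sub>v n"
  using assms by (auto simp: l2_norm_vec_def L2_set_eq_0_iff)

lemma l2_norm_vec_smult: "l2_norm_vec (c \<cdot>\<^sub>v v) = cmod c * l2_norm_vec v"
  by (auto simp: l2_norm_vec_def L2_set_right_distrib norm_mult intro!: L2_set_cong)

lemma inner_prod_self:
  assumes "v \<in> carrier_vec n"
  shows "v \<bullet>c v = of_real ((l2_norm_vec v)\<^sup>2)"
  unfolding inner_prod_sum[OF assms assms] l2_norm_vec_square[OF assms]
  by (simp add: complex_norm_square[symmetric])

lemma inner_prod_smult_real:
  fixes u v :: "complex vec" and c :: real
  assumes "u \<in> carrier_vec n" "v \<in> carrier_vec n"
  shows "(of_real c \<cdot>\<^sub>v u) \<bullet>c (of_real c \<cdot>\<^sub>v v) = of_real (c\<^sup>2) * (u \<bullet>c v)"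
  unfolding inner_prod_sum[OF assms] inner_prod_sum[OF smult_carrier_vec[THEN iffD2, OF assms(1)]
    smult_carrier_vec[THEN iffD2, OF assms(2)]]
  using assms by (auto simp: sum_distrib_left power2_eq_square mult_ac intro!: sum.cong)

lemma cauchy_schwarz_inner_prod:
  fixes u v :: "complex vec"
  assumes "u \<in> carrier_vec n" "v \<in> carrier_vec n"
  shows "cmod (u \<bullet>c v) \<le> l2_norm_vec u * l2_norm_vec v"
proof -
  have "cmod (u \<bullet>c v) \<le> (\<Sum>i<n. \<bar>cmod (u $ i)\<bar> * \<bar>cmod (v $ i)\<bar>)"
    unfolding inner_prod_sum[OF assms] by (rule sum_norm_le) (simp add: norm_mult)
  also have "\<dots> \<le> l2_norm_vec u * l2_norm_vec v"
    using L2_set_mult_ineq[of "\<lambda>i. cmod (u $ i)" "\<lambda>i. cmod (v $ i)" "{..<n}"] assms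
    by (auto simp: l2_norm_vec_def)
  finally show ?thesis .
qed

text \<open>
  The equality case of the Cauchy--Schwarz inequality, in the form in which it turns an extremal
  value of the quadratic form into an eigenvector: expand \<open>\<parallel>u - c v\<parallel>\<^sup>2\<close> for \<open>c = \<langle>u, v\<rangle>\<close>.
\<close>

lemma eq_smult_if_inner_prod_extremal:
  fixes u v :: "complex vec"
  assumes u: "u \<in> carrier_vec n" and v: "v \<in> carrier_vec n"
    and norm_v: "l2_norm_vec v = 1" and norm_u: "l2_norm_vec u \<le> cmod (u \<bullet>c v)"
  shows "u = (u \<bullet>c v) \<cdot>\<^sub>v v"
proof -
  define c where "c = u \<bullet>c v"
  have c: "c = (\<Sum>i<n. u $ i * cnj (v $ i))" unfolding c_def by (rule inner_prod_sum[OF u v])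
  have v1: "(\<Sum>i<n. (cmod (v $ i))\<^sup>2) = 1" using l2_norm_vec_square[OF v] norm_v by simp
  have expand: "(cmod (u $ i - c * v $ i))\<^sup>2 =
      (cmod (u $ i))\<^sup>2 - 2 * Re (cnj c * (u $ i * cnj (v $ i))) + (cmod c)\<^sup>2 * (cmod (v $ i))\<^sup>2" for i
    unfolding cmod_power2 by (simp add: power2_eq_square algebra_simps)
  have cross: "(\<Sum>i<n. Re (cnj c * (u $ i * cnj (v $ i)))) = Re (cnj c * c)"
    by (subst (2) c) (simp only: sum_distrib_left Re_sum)
  have cc: "Re (cnj c * c) = (cmod c)\<^sup>2" unfolding cmod_power2 by (simp add: power2_eq_square)
  have "(\<Sum>i<n. (cmod (u $ i - c * v $ i))\<^sup>2) =
      (\<Sum>i<n. (cmod (u $ i))\<^sup>2) - 2 * Re (cnj c * c) + (cmod c)\<^sup>2 * (\<Sum>i<n. (cmod (v $ i))\<^sup>2)"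
    unfolding expand by (simp only: sum.distrib sum_subtractf sum_distrib_left[symmetric] cross)
  also have "\<dots> = (l2_norm_vec u)\<^sup>2 - (cmod c)\<^sup>2"
    unfolding v1 l2_norm_vec_square[OF u] cc by simp
  also have "\<dots> \<le> 0" using power_mono[OF norm_u, of 2] by (simp add: c_def)
  finally have "(\<Sum>i<n. (cmod (u $ i - c * v $ i))\<^sup>2) = 0" by (simp add: sum_nonneg order_antisym)
  then have "u $ i = c * v $ i" if "i < n" for i
    using that by (simp add: sum_nonneg_eq_0_iff)
  then show ?thesis using u v by (auto simp: c_def[symmetric])
qed

section \<open>The suprema are attained\<close>

lemma compact_complex_square: "compact {z. \<bar>Re z\<bar> \<le> 1 \<and> \<bar>Im z\<bar> \<le> 1}"
proof -
  have "{z. \<bar>Re z\<bar> \<le> 1 \<and> \<bar>Im z\<bar> \<le> 1} =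
      (\<lambda>p. of_real (fst p) + \<i> * of_real (snd p)) ` ({-1..1} \<times> {-1..1})"
  proof (intro equalityI subsetI)
    fix z assume "z \<in> {z. \<bar>Re z\<bar> \<le> 1 \<and> \<bar>Im z\<bar> \<le> 1}"
    then have "(Re z, Im z) \<in> {-1..1} \<times> {-1..1}" by auto
    moreover have "z = of_real (fst (Re z, Im z)) + \<i> * of_real (snd (Re z, Im z))"
      by (simp add: complex_eq)
    ultimately show "z \<in> (\<lambda>p. of_real (fst p) + \<i> * of_real (snd p)) ` ({-1..1} \<times> {-1..1})"
      by (rule rev_image_eqI)
  qed auto
  moreover have "compact \<dots>"
    by (intro compact_continuous_image compact_Times compact_Icc continuous_intros)
  ultimately show ?thesis by simp
qed

text \<open>
  The unit sphere of \<open>\<complex>\<^sup>n\<close> is the image of a compact set in the product topology on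
  \<open>nat \<Rightarrow> complex\<close>: coordinates beyond \<open>n\<close> are pinned to 0 so that the ambient box is compact.
\<close>

lemma unit_sphere_Sup_attained:
  fixes F :: "complex vec \<Rightarrow> real"
  assumes n: "n \<ge> 1" and cont: "continuous_on UNIV (\<lambda>f. F (vec n f))"
  obtains x where "x \<in> carrier_vec n" "l2_norm_vec x = 1"
    "Sup {F y | y. y \<in> carrier_vec n \<and> l2_norm_vec y = 1} = F x"
    "\<And>y. y \<in> carrier_vec n \<Longrightarrow> l2_norm_vec y = 1 \<Longrightarrow> F y \<le> F x"
proof -
  define box where "box = (\<Pi>\<^sub>E i\<in>(UNIV :: nat set).
    if i < n then {z. \<bar>Re z\<bar> \<le> 1 \<and> \<bar>Im z\<bar> \<le> 1} else {0 :: complex})"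
  define S where "S = box \<inter> {f. (\<Sum>i<n. (cmod (f i))\<^sup>2) = 1}"
  have "compactin (product_topology (\<lambda>i. euclidean) UNIV) box"
    unfolding box_def by (subst compactin_PiE) (auto simp: compact_complex_square)
  then have "compact box" by (simp add: euclidean_product_topology)
  moreover have "closed {f :: nat \<Rightarrow> complex. (\<Sum>i<n. (cmod (f i))\<^sup>2) = 1}"
    by (intro closed_Collect_eq continuous_intros) auto
  ultimately have compact: "compact S" unfolding S_def by (rule compact_Int_closed)
  have in_S: "(\<lambda>i. if i < n then y $ i else 0) \<in> S"
    if y: "y \<in> carrier_vec n" "l2_norm_vec y = 1" for y
  proof -
    have sum1: "(\<Sum>i<n. (cmod (y $ i))\<^sup>2) = 1" using l2_norm_vec_square[OF y(1)] y(2) by simp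
    have "cmod (y $ i) \<le> 1" if "i < n" for i
    proof -
      have "(cmod (y $ i))\<^sup>2 \<le> (\<Sum>i<n. (cmod (y $ i))\<^sup>2)"
        using that by (intro member_le_sum) auto
      then show ?thesis using sum1 by (simp add: power_le_one_iff abs_square_le_1)
    qed
    then have "\<bar>Re (y $ i)\<bar> \<le> 1 \<and> \<bar>Im (y $ i)\<bar> \<le> 1" if "i < n" for i
      using that abs_Re_le_cmod[of "y $ i"] abs_Im_le_cmod[of "y $ i"] by force
    then show ?thesis using sum1 by (auto simp: S_def box_def PiE_iff)
  qed
  have vec_S: "vec n f \<in> carrier_vec n \<and> l2_norm_vec (vec n f) = 1" if "f \<in> S" for f
    using that by (auto simp: S_def l2_norm_vec_def L2_set_def)
  have "l2_norm_vec (unit_vec n 0) = 1"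
    using n by (simp add: l2_norm_vec_def L2_set_def if_distrib if_distribR sum.If_cases)
  then have "S \<noteq> {}" using in_S[of "unit_vec n 0"] by auto
  then obtain f where f: "f \<in> S" "\<And>g. g \<in> S \<Longrightarrow> F (vec n g) \<le> F (vec n f)"
    using continuous_attains_sup[OF compact _ continuous_on_subset[OF cont]] by blast
  have max: "F y \<le> F (vec n f)" if "y \<in> carrier_vec n" "l2_norm_vec y = 1" for y
  proof -
    have "vec n (\<lambda>i. if i < n then y $ i else 0) = y" using that by auto
    then show ?thesis using f(2)[OF in_S[OF that]] by simp
  qed
  show ?thesis
  proof (rule that[of "vec n f"])
    show "Sup {F y | y. y \<in> carrier_vec n \<and> l2_norm_vec y = 1} = F (vec n f)"
      using vec_S[OF f(1)] max by (intro cSup_eq_maximum) blast+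
  qed (use vec_S[OF f(1)] max in auto)
qed

lemma normalise_vec:
  assumes "x \<in> carrier_vec n" "x \<noteq> 0\<^sub>v n"
  obtains y where "y \<in> carrier_vec n" "l2_norm_vec y = 1" "x = of_real (l2_norm_vec x) \<cdot>\<^sub>v y"
proof -
  have pos: "l2_norm_vec x \<noteq> 0" using assms l2_norm_vec_eq_0_iff by blast
  show ?thesis
    by (rule that[of "of_real (inverse (l2_norm_vec x)) \<cdot>\<^sub>v x"])
      (use pos assms in \<open>auto simp: l2_norm_vec_smult norm_inverse\<close>)
qed

lemma spectral_norm_attained:
  assumes n: "n \<ge> 1" and A: "A \<in> carrier_mat n n"
  obtains x where "x \<in> carrier_vec n" "l2_norm_vec x = 1" "spectral_norm A = l2_norm_vec (A *\<^sub>v x)"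
    "\<And>y. y \<in> carrier_vec n \<Longrightarrow> l2_norm_vec y = 1 \<Longrightarrow> l2_norm_vec (A *\<^sub>v y) \<le> spectral_norm A"
proof -
  have "l2_norm_vec (A *\<^sub>v vec n f) = sqrt (\<Sum>i<n. (cmod (\<Sum>j<n. A $$ (i, j) * f j))\<^sup>2)" for f
    using A by (auto simp: l2_norm_vec_def L2_set_def mult_mat_vec_nth[OF A]
        simp del: index_mult_mat_vec intro!: sum.cong)
  then have "continuous_on UNIV (\<lambda>f. l2_norm_vec (A *\<^sub>v vec n f))"
    by (simp only:) (intro continuous_intros, auto)
  from unit_sphere_Sup_attained[OF n this] obtain x where
    "x \<in> carrier_vec n" "l2_norm_vec x = 1"
    "Sup {l2_norm_vec (A *\<^sub>v y) | y. y \<in> carrier_vec n \<and> l2_norm_vec y = 1} = l2_norm_vec (A *\<^sub>v x)"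
    "\<And>y. y \<in> carrier_vec n \<Longrightarrow> l2_norm_vec y = 1 \<Longrightarrow> l2_norm_vec (A *\<^sub>v y) \<le> l2_norm_vec (A *\<^sub>v x)" by blast
  then show ?thesis using A by (intro that[of x]) (simp_all add: spectral_norm_def)
qed

lemma numerical_radius_attained:
  assumes n: "n \<ge> 1" and A: "A \<in> carrier_mat n n"
  obtains x where "x \<in> carrier_vec n" "l2_norm_vec x = 1"
    "numerical_radius A = cmod ((A *\<^sub>v x) \<bullet>c x)"
    "\<And>y. y \<in> carrier_vec n \<Longrightarrow> l2_norm_vec y = 1 \<Longrightarrow> cmod ((A *\<^sub>v y) \<bullet>c y) \<le> numerical_radius A"
proof -
  have "(A *\<^sub>v vec n f) \<bullet>c vec n f = (\<Sum>i<n. (\<Sum>j<n. A $$ (i, j) * f j) * cnj (f i))" for f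
    using A by (subst inner_prod_sum[of _ n])
      (auto simp: mult_mat_vec_nth[OF A] simp del: index_mult_mat_vec intro!: sum.cong)
  then have "continuous_on UNIV (\<lambda>f. cmod ((A *\<^sub>v vec n f) \<bullet>c vec n f))"
    by (simp only:) (intro continuous_intros, auto)
  from unit_sphere_Sup_attained[OF n this] obtain x where
    "x \<in> carrier_vec n" "l2_norm_vec x = 1"
    "Sup {cmod ((A *\<^sub>v y) \<bullet>c y) | y. y \<in> carrier_vec n \<and> l2_norm_vec y = 1} = cmod ((A *\<^sub>v x) \<bullet>c x)"
    "\<And>y. y \<in> carrier_vec n \<Longrightarrow> l2_norm_vec y = 1 \<Longrightarrow> cmod ((A *\<^sub>v y) \<bullet>c y) \<le> cmod ((A *\<^sub>v x) \<bullet>c x)" by blast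
  then show ?thesis using A by (intro that[of x]) (simp_all add: numerical_radius_def)
qed

lemma l2_norm_mult_mat_vec_le:
  assumes n: "n \<ge> 1" and A: "A \<in> carrier_mat n n" and x: "x \<in> carrier_vec n"
  shows "l2_norm_vec (A *\<^sub>v x) \<le> spectral_norm A * l2_norm_vec x"
proof (cases "x = 0\<^sub>v n")
  case True
  have "A *\<^sub>v 0\<^sub>v n = 0\<^sub>v n" using A by auto
  then show ?thesis using True l2_norm_vec_eq_0_iff[of "0\<^sub>v n" n] by simp
next
  case False
  then obtain y where y: "y \<in> carrier_vec n" "l2_norm_vec y = 1"
    "x = of_real (l2_norm_vec x) \<cdot>\<^sub>v y" using normalise_vec x by metis
  have "l2_norm_vec (A *\<^sub>v y) \<le> spectral_norm A" using spectral_norm_attained[OF n A] y by metis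
  moreover have "l2_norm_vec (A *\<^sub>v x) = l2_norm_vec x * l2_norm_vec (A *\<^sub>v y)"
    by (subst y(3)) (simp add: mult_mat_vec[OF A y(1)] l2_norm_vec_smult)
  ultimately show ?thesis by (metis mult.commute mult_left_mono l2_norm_vec_nonneg)
qed

lemma quadratic_form_le:
  assumes n: "n \<ge> 1" and A: "A \<in> carrier_mat n n" and x: "x \<in> carrier_vec n"
  shows "cmod ((A *\<^sub>v x) \<bullet>c x) \<le> numerical_radius A * (l2_norm_vec x)\<^sup>2"
proof (cases "x = 0\<^sub>v n")
  case True
  then have "(A *\<^sub>v x) \<bullet>c x = 0" using A by (subst inner_prod_sum[of _ n]) auto
  then show ?thesis using True l2_norm_vec_eq_0_iff[of "0\<^sub>v n" n] by simp
next
  case False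
  then obtain y where y: "y \<in> carrier_vec n" "l2_norm_vec y = 1"
    "x = of_real (l2_norm_vec x) \<cdot>\<^sub>v y" using normalise_vec x by metis
  have Ay: "A *\<^sub>v y \<in> carrier_vec n" by (rule mult_mat_vec_carrier[OF A y(1)])
  have Ax: "A *\<^sub>v x = of_real (l2_norm_vec x) \<cdot>\<^sub>v (A *\<^sub>v y)"
    by (subst y(3)) (rule mult_mat_vec[OF A y(1)])
  have "(A *\<^sub>v x) \<bullet>c x =
      (of_real (l2_norm_vec x) \<cdot>\<^sub>v (A *\<^sub>v y)) \<bullet>c (of_real (l2_norm_vec x) \<cdot>\<^sub>v y)"
    by (simp only: Ax y(3)[symmetric])
  also have "\<dots> = of_real ((l2_norm_vec x)\<^sup>2) * ((A *\<^sub>v y) \<bullet>c y)"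
    by (rule inner_prod_smult_real[OF Ay y(1)])
  finally have "(A *\<^sub>v x) \<bullet>c x = of_real ((l2_norm_vec x)\<^sup>2) * ((A *\<^sub>v y) \<bullet>c y)" .
  then have "cmod ((A *\<^sub>v x) \<bullet>c x) = (l2_norm_vec x)\<^sup>2 * cmod ((A *\<^sub>v y) \<bullet>c y)"
    by (simp add: norm_mult norm_power)
  moreover have "cmod ((A *\<^sub>v y) \<bullet>c y) \<le> numerical_radius A"
    using numerical_radius_attained[OF n A] y by metis
  ultimately show ?thesis by (metis mult.commute mult_left_mono zero_le_power2)
qed

lemma spectral_norm_nonneg:
  assumes "n \<ge> 1" "A \<in> carrier_mat n n"
  shows "0 \<le> spectral_norm A"
  using spectral_norm_attained[OF assms] by (metis l2_norm_vec_nonneg)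

lemma numerical_radius_nonneg:
  assumes "n \<ge> 1" "A \<in> carrier_mat n n"
  shows "0 \<le> numerical_radius A"
  using numerical_radius_attained[OF assms] by (metis norm_ge_zero)

lemma column_norm_le:
  assumes n: "n \<ge> 1" and A: "A \<in> carrier_mat n n" and j: "j < n"
  shows "(\<Sum>i<n. (cmod (A $$ (i, j)))\<^sup>2) \<le> (spectral_norm A)\<^sup>2"
proof -
  have e: "unit_vec n j \<in> carrier_vec n" "l2_norm_vec (unit_vec n j) = 1"
    using j by (simp_all add: l2_norm_vec_def L2_set_def if_distrib if_distribR sum.If_cases)
  have "(A *\<^sub>v unit_vec n j) $ i = A $$ (i, j)" if "i < n" for i
    using that j A by (simp add: mult_mat_vec_nth[OF A] if_distrib sum.If_cases
        del: index_mult_mat_vec)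
  then have "(l2_norm_vec (A *\<^sub>v unit_vec n j))\<^sup>2 = (\<Sum>i<n. (cmod (A $$ (i, j)))\<^sup>2)"
    using A by (subst l2_norm_vec_square[of _ n]) auto
  moreover have "l2_norm_vec (A *\<^sub>v unit_vec n j) \<le> spectral_norm A"
    using l2_norm_mult_mat_vec_le[OF n A e(1)] e(2) by simp
  ultimately show ?thesis by (metis l2_norm_vec_nonneg power_mono)
qed

text \<open>
  For rows, test the norm on the conjugate of the \<open>k\<close>-th row: the \<open>k\<close>-th coordinate of its image
  is its squared norm.
\<close>

lemma row_norm_le:
  assumes n: "n \<ge> 1" and A: "A \<in> carrier_mat n n" and k: "k < n"
  shows "(\<Sum>j<n. (cmod (A $$ (k, j)))\<^sup>2) \<le> (spectral_norm A)\<^sup>2"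
proof -
  define x where "x = vec n (\<lambda>j. cnj (A $$ (k, j)))"
  define r where "r = l2_norm_vec x"
  have x: "x \<in> carrier_vec n" by (simp add: x_def)
  have r2: "r\<^sup>2 = (\<Sum>j<n. (cmod (A $$ (k, j)))\<^sup>2)"
    unfolding r_def l2_norm_vec_square[OF x] by (simp add: x_def)
  have "(A *\<^sub>v x) $ k = of_real (r\<^sup>2)"
    unfolding r2 mult_mat_vec_nth[OF A x k] by (simp add: x_def complex_norm_square[symmetric])
  then have "r\<^sup>2 = cmod ((A *\<^sub>v x) $ k)" by (simp add: norm_power)
  also have "\<dots> \<le> l2_norm_vec (A *\<^sub>v x)"
    unfolding l2_norm_vec_def using k A by (intro member_le_L2_set) auto
  also have "\<dots> \<le> spectral_norm A * r" unfolding r_def by (rule l2_norm_mult_mat_vec_le[OF n A x])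
  finally have "r * r \<le> spectral_norm A * r" by (simp add: power2_eq_square)
  moreover have r0: "0 \<le> r" by (simp add: r_def)
  ultimately have "r \<le> spectral_norm A"
    using spectral_norm_nonneg[OF n A] by (cases "r = 0") (auto simp: mult_le_cancel_right)
  then show ?thesis unfolding r2[symmetric] using r0 by (rule power_mono)
qed

section \<open>Kronecker powers\<close>

lemma sum_mult_index:
  fixes f :: "nat \<Rightarrow> 'a :: comm_monoid_add"
  shows "(\<Sum>i<p * q. f i) = (\<Sum>i<p. \<Sum>k<q. f (i * q + k))"
proof -
  have "sum f {i * q..<i * q + q} = (\<Sum>k<q. f (i * q + k))" for i
    using sum.shift_bounds_nat_ivl[of f 0 "i * q" q] by (simp add: atLeast0LessThan add.commute)
  then show ?thesis by (simp add: sum.nat_group[symmetric])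
qed

lemma mult_index_less:
  fixes i k p q :: nat
  assumes "i < p" "k < q"
  shows "i * q + k < p * q"
proof -
  have "i * q + k < Suc i * q" using assms by simp
  also have "\<dots> \<le> p * q" using assms by (intro mult_right_mono) auto
  finally show ?thesis .
qed

lemma kronecker_mat_nth:
  assumes "A \<in> carrier_mat p p'" "B \<in> carrier_mat q q'" "i < p" "k < q" "j < p'" "l < q'"
  shows "kronecker_mat A B $$ (i * q + k, j * q' + l) = A $$ (i, j) * B $$ (k, l)"
  using assms by (auto simp: kronecker_mat_def mult_index_less)

text \<open>
  Arrange the argument as a matrix; then \<open>A \<otimes> B\<close> applies \<open>B\<close> to every row and \<open>A\<close> to every
  resulting column, and each of the two steps costs one operator bound.
\<close>

lemma l2_norm_kronecker_mat_le:
  assumes A: "A \<in> carrier_mat p p'" and B: "B \<in> carrier_mat q q'" and a: "0 \<le> a" and b: "0 \<le> b"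
    and bound_A: "\<And>x. x \<in> carrier_vec p' \<Longrightarrow> l2_norm_vec (A *\<^sub>v x) \<le> a * l2_norm_vec x"
    and bound_B: "\<And>x. x \<in> carrier_vec q' \<Longrightarrow> l2_norm_vec (B *\<^sub>v x) \<le> b * l2_norm_vec x"
    and v: "v \<in> carrier_vec (p' * q')"
  shows "l2_norm_vec (kronecker_mat A B *\<^sub>v v) \<le> (a * b) * l2_norm_vec v"
proof -
  define w where "w j = vec q' (\<lambda>l. v $ (j * q' + l))" for j
  define z where "z k = vec p' (\<lambda>j. (B *\<^sub>v w j) $ k)" for k
  have w: "w j \<in> carrier_vec q'" and z: "z k \<in> carrier_vec p'" for j k
    by (simp_all add: w_def z_def)
  have K: "kronecker_mat A B \<in> carrier_mat (p * q) (p' * q')"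
    using A B by (simp add: kronecker_mat_def)
  have sq_A: "(l2_norm_vec (A *\<^sub>v x))\<^sup>2 \<le> a\<^sup>2 * (l2_norm_vec x)\<^sup>2" if "x \<in> carrier_vec p'" for x
    using power_mono[OF bound_A[OF that], of 2] by (simp add: power_mult_distrib)
  have sq_B: "(l2_norm_vec (B *\<^sub>v x))\<^sup>2 \<le> b\<^sup>2 * (l2_norm_vec x)\<^sup>2" if "x \<in> carrier_vec q'" for x
    using power_mono[OF bound_B[OF that], of 2] by (simp add: power_mult_distrib)
  have norm_v: "(l2_norm_vec v)\<^sup>2 = (\<Sum>j<p'. (l2_norm_vec (w j))\<^sup>2)"
    unfolding l2_norm_vec_square[OF v] l2_norm_vec_square[OF w] sum_mult_index
    by (simp add: w_def)
  have entry: "(kronecker_mat A B *\<^sub>v v) $ (i * q + k) = (A *\<^sub>v z k) $ i" if "i < p" "k < q" for i k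
  proof -
    have "(kronecker_mat A B *\<^sub>v v) $ (i * q + k) =
        (\<Sum>j<p'. \<Sum>l<q'. A $$ (i, j) * B $$ (k, l) * v $ (j * q' + l))"
      unfolding mult_mat_vec_nth[OF K v mult_index_less[OF that]] sum_mult_index
      using that by (simp add: kronecker_mat_nth[OF A B])
    also have "\<dots> = (\<Sum>j<p'. A $$ (i, j) * (B *\<^sub>v w j) $ k)"
      unfolding mult_mat_vec_nth[OF B w that(2)]
      by (simp add: sum_distrib_left w_def mult.assoc)
    also have "\<dots> = (A *\<^sub>v z k) $ i"
      unfolding mult_mat_vec_nth[OF A z that(1)] by (simp add: z_def)
    finally show ?thesis .
  qed
  have "(l2_norm_vec (kronecker_mat A B *\<^sub>v v))\<^sup>2 = (\<Sum>i<p. \<Sum>k<q. (cmod ((A *\<^sub>v z k) $ i))\<^sup>2)"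
    unfolding l2_norm_vec_square[OF mult_mat_vec_carrier[OF K v]] sum_mult_index
    by (intro sum.cong refl) (simp add: entry)
  also have "\<dots> = (\<Sum>k<q. (l2_norm_vec (A *\<^sub>v z k))\<^sup>2)"
    unfolding l2_norm_vec_square[OF mult_mat_vec_carrier[OF A z]] by (rule sum.swap)
  also have "\<dots> \<le> (\<Sum>k<q. a\<^sup>2 * (l2_norm_vec (z k))\<^sup>2)" by (intro sum_mono sq_A z)
  also have "\<dots> = a\<^sup>2 * (\<Sum>k<q. \<Sum>j<p'. (cmod ((B *\<^sub>v w j) $ k))\<^sup>2)"
    unfolding l2_norm_vec_square[OF z] by (simp add: sum_distrib_left z_def)
  also have "\<dots> = a\<^sup>2 * (\<Sum>j<p'. (l2_norm_vec (B *\<^sub>v w j))\<^sup>2)"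
    unfolding l2_norm_vec_square[OF mult_mat_vec_carrier[OF B w]] by (subst sum.swap) (rule refl)
  also have "\<dots> \<le> a\<^sup>2 * (\<Sum>j<p'. b\<^sup>2 * (l2_norm_vec (w j))\<^sup>2)"
    by (intro mult_left_mono sum_mono sq_B w) simp
  also have "\<dots> = ((a * b) * l2_norm_vec v)\<^sup>2"
    unfolding power_mult_distrib norm_v by (simp add: sum_distrib_left mult.assoc)
  finally show ?thesis by (rule power2_le_imp_le) (use a b in simp)
qed

lemma l2_norm_kronecker_mat_power_le:
  assumes n: "n \<ge> 1" and A: "A \<in> carrier_mat n n" and v: "v \<in> carrier_vec (n ^ m)"
  shows "l2_norm_vec (kronecker_mat_power A m *\<^sub>v v) \<le> spectral_norm A ^ m * l2_norm_vec v"
  using v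
proof (induction m arbitrary: v)
  case 0
  then show ?case by simp
next
  case (Suc m)
  show ?case
    unfolding kronecker_mat_power.simps power_Suc
    by (rule l2_norm_kronecker_mat_le[OF A kronecker_mat_power_carrier[OF A]])
      (use Suc spectral_norm_nonneg[OF n A] l2_norm_mult_mat_vec_le[OF n A] in auto)
qed

section \<open>The diagonal of a tensor power\<close>

text \<open>
  The position of the index tuple \<open>(j, \<dots>, j)\<close> in the enumeration of \<open>\<complex>\<^sup>n \<otimes> \<dots> \<otimes> \<complex>\<^sup>n\<close>, that is, the
  number with \<open>m\<close> digits \<open>j\<close> in base \<open>n\<close>.
\<close>

primrec diag_index :: "nat \<Rightarrow> nat \<Rightarrow> nat \<Rightarrow> nat" where
  "diag_index n 0 j = 0"
| "diag_index n (Suc m) j = j * n ^ m + diag_index n m j"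

lemma diag_index_less: "j < n \<Longrightarrow> diag_index n m j < n ^ m"
  by (induction m) (auto simp: mult_index_less)

lemma inj_on_diag_index:
  assumes "m \<ge> 1"
  shows "inj_on (diag_index n m) {..<n}"
proof -
  obtain r where m: "m = Suc r" using assms by (cases m) auto
  have "diag_index n m j div n ^ r = j" if "j < n" for j
  proof -
    have "n ^ r \<noteq> 0" using that by auto
    then show ?thesis using diag_index_less[OF that, of r] by (simp add: m)
  qed
  then show ?thesis by (metis inj_onI lessThan_iff)
qed

lemma kronecker_vec_unit_vec:
  assumes "i < p" "k < q"
  shows "kronecker_vec (unit_vec p i) (unit_vec q k) = unit_vec (p * q) (i * q + k)"
proof
  fix l assume "l < dim_vec (unit_vec (p * q) (i * q + k) :: complex vec)"
  then have l: "l < p * q" by simp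
  then have "l div q < p" by (simp add: less_mult_imp_div_less)
  moreover have "l mod q < q" using assms by simp
  moreover have "l div q = i \<and> l mod q = k \<longleftrightarrow> l = i * q + k"
    using assms by auto
  ultimately show "kronecker_vec (unit_vec p i) (unit_vec q k) $ l =
      (unit_vec (p * q) (i * q + k) :: complex vec) $ l"
    using assms l mult_index_less[OF assms] by (auto simp: kronecker_vec_def)
qed (simp add: kronecker_vec_def)

lemma kronecker_vec_power_unit_vec:
  assumes "j < n"
  shows "kronecker_vec_power (unit_vec n j) m = unit_vec (n ^ m) (diag_index n m j)"
proof (induction m)
  case 0
  show ?case by (intro eq_vecI) auto
next
  case (Suc m)
  then show ?case by (simp add: kronecker_vec_unit_vec assms diag_index_less)
qed

lemma kronecker_mat_power_diag_nth:
  assumes A: "A \<in> carrier_mat n n" and "k < n" "j < n"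
  shows "kronecker_mat_power A m $$ (diag_index n m k, diag_index n m j) = A $$ (k, j) ^ m"
  by (induction m)
    (simp_all add: kronecker_mat_nth[OF A kronecker_mat_power_carrier[OF A]] diag_index_less assms)

lemma span_unit_vecs_subset:
  assumes D: "D \<subseteq> {..<d}"
  shows "span_vec d (unit_vec d ` D) = {v \<in> carrier_vec d. \<forall>i<d. i \<notin> D \<longrightarrow> v $ i = 0}"
proof -
  interpret vec_space "TYPE(complex)" d .
  have carrier: "unit_vec d ` D \<subseteq> carrier_vec d" by auto
  have fin: "finite D" using D finite_subset by blast
  show ?thesis
  proof (intro equalityI subsetI)
    fix v assume "v \<in> span_vec d (unit_vec d ` D)"
    then obtain a S where v: "v = lincomb a S" and S: "finite S" "S \<subseteq> unit_vec d ` D"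
      using in_spanE by blast
    have S': "S \<subseteq> carrier_vec d" using S carrier by blast
    have "v $ i = 0" if "i < d" "i \<notin> D" for i
      unfolding v lincomb_index[OF that(1) S']
    proof (intro sum.neutral ballI)
      fix u assume "u \<in> S"
      then obtain j where "u = unit_vec d j" "j \<in> D" using S(2) by blast
      moreover from this have "j < d" "i \<noteq> j" using D that by auto
      ultimately show "a u * u $ i = 0" using that by simp
    qed
    moreover have "v \<in> carrier_vec d" unfolding v by (rule lincomb_closed[OF S'])
    ultimately show "v \<in> {v \<in> carrier_vec d. \<forall>i<d. i \<notin> D \<longrightarrow> v $ i = 0}" by blast
  next
    fix v :: "complex vec" assume "v \<in> {v \<in> carrier_vec d. \<forall>i<d. i \<notin> D \<longrightarrow> v $ i = 0}"
    then have v: "v \<in> carrier_vec d" and supp: "\<And>i. i < d \<Longrightarrow> i \<notin> D \<Longrightarrow> v $ i = 0" by auto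
    have inj: "inj_on (unit_vec d :: nat \<Rightarrow> complex vec) D"
      using D by (auto simp: inj_on_def)
    have "v = lincomb (\<lambda>u. v \<bullet> u) (unit_vec d ` D)"
    proof (rule eq_vecI)
      show "dim_vec v = dim_vec (lincomb (\<lambda>u. v \<bullet> u) (unit_vec d ` D))"
        using v by (simp add: lincomb_dim[OF finite_imageI[OF fin] carrier])
      fix i assume "i < dim_vec (lincomb (\<lambda>u. v \<bullet> u) (unit_vec d ` D))"
      then have i: "i < d" by (simp add: lincomb_dim[OF finite_imageI[OF fin] carrier])
      have "lincomb (\<lambda>u. v \<bullet> u) (unit_vec d ` D) $ i =
          (\<Sum>j\<in>D. if i = j then v $ j else 0)"
        unfolding lincomb_index[OF i carrier] sum.reindex[OF inj]
        using D v i by (intro sum.cong) auto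
      also have "\<dots> = v $ i" using supp[OF i] fin by simp
      finally show "v $ i = lincomb (\<lambda>u. v \<bullet> u) (unit_vec d ` D) $ i" by simp
    qed
    then show "v \<in> span_vec d (unit_vec d ` D)" using fin by (intro in_spanI) auto
  qed
qed

lemma sum_supported_on_diag:
  fixes f :: "nat \<Rightarrow> 'a :: comm_monoid_add"
  assumes m: "m \<ge> 1" and supp: "\<And>i. i < n ^ m \<Longrightarrow> i \<notin> diag_index n m ` {..<n} \<Longrightarrow> f i = 0"
  shows "(\<Sum>i<n ^ m. f i) = (\<Sum>j<n. f (diag_index n m j))"
proof -
  have "(\<Sum>i<n ^ m. f i) = (\<Sum>i\<in>diag_index n m ` {..<n}. f i)"
    using supp diag_index_less by (intro sum.mono_neutral_right) auto
  then show ?thesis by (simp add: sum.reindex[OF inj_on_diag_index[OF m]])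
qed

lemma diag_supported_norm:
  assumes m: "m \<ge> 1" and v: "v \<in> carrier_vec (n ^ m)"
    and supp: "\<And>i. i < n ^ m \<Longrightarrow> i \<notin> diag_index n m ` {..<n} \<Longrightarrow> v $ i = 0"
  shows "l2_norm_vec (vec n (\<lambda>j. v $ diag_index n m j)) = l2_norm_vec v"
proof (rule power2_eq_imp_eq)
  show "(l2_norm_vec (vec n (\<lambda>j. v $ diag_index n m j)))\<^sup>2 = (l2_norm_vec v)\<^sup>2"
    unfolding l2_norm_vec_square[OF v] by (subst l2_norm_vec_square[of _ n], simp,
      subst sum_supported_on_diag[OF m]) (use supp in auto)
qed auto

text \<open>
  The Hadamard power is the compression of the Kronecker power to the diagonal tensors, because the
  entries of \<open>A \<otimes> \<dots> \<otimes> A\<close> at diagonal positions are the powers \<open>a\<^sub>k\<^sub>j\<^sup>m\<close>.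
\<close>

lemma hadamard_power_compression:
  assumes m: "m \<ge> 1" and A: "A \<in> carrier_mat n n" and v: "v \<in> carrier_vec (n ^ m)"
    and supp: "\<And>i. i < n ^ m \<Longrightarrow> i \<notin> diag_index n m ` {..<n} \<Longrightarrow> v $ i = 0"
  defines "x \<equiv> vec n (\<lambda>j. v $ diag_index n m j)"
  shows "(kronecker_mat_power A m *\<^sub>v v) \<bullet>c v = (hadamard_power A m *\<^sub>v x) \<bullet>c x"
proof -
  let ?d = "diag_index n m" and ?M = "kronecker_mat_power A m"
  have M: "?M \<in> carrier_mat (n ^ m) (n ^ m)" by (rule kronecker_mat_power_carrier[OF A])
  have H: "hadamard_power A m \<in> carrier_mat n n" using A by (simp add: hadamard_power_def)
  have x: "x \<in> carrier_vec n" by (simp add: x_def)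
  have Mv: "(?M *\<^sub>v v) $ ?d k = (hadamard_power A m *\<^sub>v x) $ k" if k: "k < n" for k
  proof -
    have "(?M *\<^sub>v v) $ ?d k = (\<Sum>j<n. ?M $$ (?d k, ?d j) * v $ ?d j)"
      unfolding mult_mat_vec_nth[OF M v diag_index_less[OF k]]
      using supp by (intro sum_supported_on_diag[OF m]) auto
    also have "\<dots> = (hadamard_power A m *\<^sub>v x) $ k"
      unfolding mult_mat_vec_nth[OF H x k] using k A
      by (intro sum.cong) (auto simp: kronecker_mat_power_diag_nth[OF A] x_def hadamard_power_def)
    finally show ?thesis .
  qed
  have "(?M *\<^sub>v v) \<bullet>c v = (\<Sum>i<n ^ m. (?M *\<^sub>v v) $ i * cnj (v $ i))"
    using M v by (intro inner_prod_sum) auto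
  also have "\<dots> = (\<Sum>k<n. (?M *\<^sub>v v) $ ?d k * cnj (v $ ?d k))"
    using supp by (intro sum_supported_on_diag[OF m]) auto
  also have "\<dots> = (\<Sum>k<n. (hadamard_power A m *\<^sub>v x) $ k * cnj (x $ k))"
    by (intro sum.cong) (auto simp: Mv x_def simp del: index_mult_mat_vec)
  also have "\<dots> = (hadamard_power A m *\<^sub>v x) \<bullet>c x"
    using H x by (intro inner_prod_sum[symmetric]) auto
  finally show ?thesis .
qed

lemma obtain_diag_supported:
  assumes m: "m \<ge> 1" and x: "x \<in> carrier_vec n"
  obtains v where "v \<in> carrier_vec (n ^ m)"
    "\<And>i. i < n ^ m \<Longrightarrow> i \<notin> diag_index n m ` {..<n} \<Longrightarrow> v $ i = 0"
    "vec n (\<lambda>j. v $ diag_index n m j) = x"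
proof -
  let ?d = "diag_index n m"
  define v where "v = vec (n ^ m)
    (\<lambda>i. if i \<in> ?d ` {..<n} then x $ the_inv_into {..<n} ?d i else 0)"
  show ?thesis
  proof (rule that[of v])
    show "vec n (\<lambda>j. v $ ?d j) = x"
      using x diag_index_less
      by (intro eq_vecI) (auto simp: v_def the_inv_into_f_f[OF inj_on_diag_index[OF m]])
  qed (auto simp: v_def)
qed

lemma numerical_radius_hadamard_power_le:
  assumes n: "n \<ge> 1" and m: "m \<ge> 1" and A: "A \<in> carrier_mat n n"
  shows "numerical_radius (hadamard_power A m) \<le> spectral_norm A ^ m"
proof -
  let ?M = "kronecker_mat_power A m"
  have H: "hadamard_power A m \<in> carrier_mat n n" using A by (simp add: hadamard_power_def)
  obtain x where x: "x \<in> carrier_vec n" "l2_norm_vec x = 1"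
    "numerical_radius (hadamard_power A m) = cmod ((hadamard_power A m *\<^sub>v x) \<bullet>c x)"
    using numerical_radius_attained[OF n H] by metis
  obtain v where v: "v \<in> carrier_vec (n ^ m)"
    "\<And>i. i < n ^ m \<Longrightarrow> i \<notin> diag_index n m ` {..<n} \<Longrightarrow> v $ i = 0"
    "vec n (\<lambda>j. v $ diag_index n m j) = x"
    using obtain_diag_supported[OF m x(1)] by metis
  have v1: "l2_norm_vec v = 1" using diag_supported_norm[OF m v(1,2)] v(3) x(2) by simp
  have Mv: "?M *\<^sub>v v \<in> carrier_vec (n ^ m)" 
    by (rule mult_mat_vec_carrier[OF kronecker_mat_power_carrier[OF A] v(1)])
  have "numerical_radius (hadamard_power A m) = cmod ((?M *\<^sub>v v) \<bullet>c v)"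
    using hadamard_power_compression[OF m A v(1,2)] v(3) x(3) by simp
  also have "\<dots> \<le> l2_norm_vec (?M *\<^sub>v v)"
    using cauchy_schwarz_inner_prod[OF Mv v(1)] v1 by simp
  also have "\<dots> \<le> spectral_norm A ^ m"
    using l2_norm_kronecker_mat_power_le[OF n A v(1)] v1 by simp
  finally show ?thesis .
qed

section \<open>Extremal coefficient arrays\<close>

text \<open>
  Bounding \<open>b\<^sub>k\<^sub>j\<^sup>r\<^sup>+\<^sup>2 t\<^sub>j t\<^sub>k\<close> first by \<open>N\<^sup>r b\<^sub>k\<^sub>j\<^sup>2 t\<^sub>j t\<^sub>k\<close> and then, by the arithmetic-geometric mean
  inequality, by \<open>N\<^sup>r b\<^sub>k\<^sub>j\<^sup>2 (t\<^sub>j\<^sup>2 + t\<^sub>k\<^sup>2) / 2\<close> shows that the sum is at most \<open>N\<^sup>r\<^sup>+\<^sup>2\<close>. If it reaches this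
  value, no step loses anything: the rows in the support of \<open>t\<close> have norm \<open>N\<close>, nonzero entries only
  join indices with equal \<open>t\<close>, and, as \<open>r > 0\<close>, those within the support have the maximal value \<open>N\<close>.
  A row of norm \<open>N\<close> has room for just one entry of that size.
\<close>

lemma extremal_row_has_single_entry:
  fixes b :: "nat \<Rightarrow> nat \<Rightarrow> real" and t :: "nat \<Rightarrow> real"
  assumes N: "N > 0" and r: "r > 0"
    and b0: "\<And>k j. k < n \<Longrightarrow> j < n \<Longrightarrow> 0 \<le> b k j"
    and rows: "\<And>k. k < n \<Longrightarrow> (\<Sum>j<n. (b k j)\<^sup>2) \<le> N\<^sup>2"
    and cols: "\<And>j. j < n \<Longrightarrow> (\<Sum>k<n. (b k j)\<^sup>2) \<le> N\<^sup>2"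
    and t0: "\<And>k. k < n \<Longrightarrow> 0 \<le> t k" and t1: "(\<Sum>k<n. (t k)\<^sup>2) = 1"
    and ext: "N ^ (r + 2) \<le> (\<Sum>k<n. \<Sum>j<n. b k j ^ (r + 2) * (t j * t k))"
    and k: "k < n" "t k > 0"
  obtains j where "j < n" "t j > 0" "b k j = N" "\<And>i. i < n \<Longrightarrow> i \<noteq> j \<Longrightarrow> b k i = 0"
proof -
  \<comment> \<open>\<open>R\<close>, \<open>C\<close>, \<open>E\<close> and \<open>G\<close> are the losses in the row bound, the column bound, the
    arithmetic-geometric mean inequality and the entrywise bound.\<close>
  define T where "T = (\<Sum>k<n. \<Sum>j<n. (b k j)\<^sup>2 * (t j * t k))"
  define R where "R k = (t k)\<^sup>2 * (N\<^sup>2 - (\<Sum>j<n. (b k j)\<^sup>2))" for k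
  define C where "C j = (t j)\<^sup>2 * (N\<^sup>2 - (\<Sum>k<n. (b k j)\<^sup>2))" for j
  define E where "E k j = (b k j)\<^sup>2 * (t j - t k)\<^sup>2" for k j
  define G where "G k j = (N ^ r - b k j ^ r) * ((b k j)\<^sup>2 * (t j * t k))" for k j
  have bN: "b k j \<le> N" if "k < n" "j < n" for k j
  proof -
    have "(b k j)\<^sup>2 \<le> (\<Sum>j<n. (b k j)\<^sup>2)" using that by (intro member_le_sum) auto
    also have "\<dots> \<le> N\<^sup>2" by (rule rows[OF that(1)])
    finally show ?thesis by (rule power2_le_imp_le) (use N in simp)
  qed
  have R0: "0 \<le> R k" if "k < n" for k using rows[OF that] by (simp add: R_def)
  have C0: "0 \<le> C k" if "k < n" for k using cols[OF that] by (simp add: C_def)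
  have E0: "0 \<le> E k j" for k j by (simp add: E_def)
  have G0: "0 \<le> G k j" if "k < n" "j < n" for k j
    using bN[OF that] b0[OF that] t0[OF that(1)] t0[OF that(2)] by (simp add: G_def power_mono)
  have sum_t: "(\<Sum>k<n. (t k)\<^sup>2 * N\<^sup>2) = N\<^sup>2" by (simp add: sum_distrib_right[symmetric] t1)
  have row_part: "(\<Sum>k<n. \<Sum>j<n. (b k j)\<^sup>2 * (t k)\<^sup>2) = N\<^sup>2 - sum R {..<n}"
    using sum_t
    by (simp add: R_def right_diff_distrib sum_subtractf sum_distrib_left mult.commute)
  have "(\<Sum>k<n. \<Sum>j<n. (b k j)\<^sup>2 * (t j)\<^sup>2) = (\<Sum>j<n. \<Sum>k<n. (b k j)\<^sup>2 * (t j)\<^sup>2)"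
    by (rule sum.swap)
  also have "\<dots> = N\<^sup>2 - sum C {..<n}"
    using sum_t
    by (simp add: C_def right_diff_distrib sum_subtractf sum_distrib_left mult.commute)
  finally have col_part: "(\<Sum>k<n. \<Sum>j<n. (b k j)\<^sup>2 * (t j)\<^sup>2) = N\<^sup>2 - sum C {..<n}" .
  have "E k j = (b k j)\<^sup>2 * (t j)\<^sup>2 + (b k j)\<^sup>2 * (t k)\<^sup>2 - 2 * ((b k j)\<^sup>2 * (t j * t k))" for k j
    by (simp add: E_def power2_eq_square algebra_simps)
  then have "(\<Sum>k<n. \<Sum>j<n. E k j) = (\<Sum>k<n. \<Sum>j<n. (b k j)\<^sup>2 * (t j)\<^sup>2) +
      (\<Sum>k<n. \<Sum>j<n. (b k j)\<^sup>2 * (t k)\<^sup>2) - 2 * T"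
    by (simp add: T_def sum.distrib sum_subtractf sum_distrib_left)
  then have two_T: "2 * T = 2 * N\<^sup>2 - (sum R {..<n} + sum C {..<n} + (\<Sum>k<n. \<Sum>j<n. E k j))"
    unfolding row_part col_part by simp
  have "b k j ^ (r + 2) * (t j * t k) = N ^ r * ((b k j)\<^sup>2 * (t j * t k)) - G k j" for k j
    by (simp add: G_def power_add power2_eq_square left_diff_distrib mult.assoc)
  then have "(\<Sum>k<n. \<Sum>j<n. b k j ^ (r + 2) * (t j * t k)) = N ^ r * T - (\<Sum>k<n. \<Sum>j<n. G k j)"
    by (simp add: T_def sum_subtractf sum_distrib_left)
  then have loss: "(\<Sum>k<n. \<Sum>j<n. G k j) \<le> N ^ r * (T - N\<^sup>2)"
    using ext unfolding power_add right_diff_distrib by linarith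
  have sumR: "0 \<le> sum R {..<n}" and sumC: "0 \<le> sum C {..<n}"
    and sumE: "0 \<le> (\<Sum>k<n. \<Sum>j<n. E k j)" and sumG: "0 \<le> (\<Sum>k<n. \<Sum>j<n. G k j)"
    using R0 C0 E0 G0 by (auto intro!: sum_nonneg)
  have "0 \<le> T - N\<^sup>2"
    using order_trans[OF sumG loss]
      mult_le_cancel_left_pos[OF zero_less_power[OF N, of r], of 0 "T - N\<^sup>2"]
    by (simp only: mult_zero_right)
  then have R1: "sum R {..<n} = 0" and E1: "(\<Sum>k<n. \<Sum>j<n. E k j) = 0" and T: "T = N\<^sup>2"
    using two_T sumR sumC sumE by linarith+
  have G1: "(\<Sum>k<n. \<Sum>j<n. G k j) = 0" using loss sumG by (simp add: T)
  have Rk: "R k = 0" by (rule sum_nonneg_0[OF _ _ R1]) (use R0 k(1) in auto)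
  have "(\<Sum>j<n. E k j) = 0"
    by (rule sum_nonneg_0[OF _ _ E1]) (use E0 k(1) in \<open>auto intro: sum_nonneg\<close>)
  then have Ekj: "E k j = 0" if "j < n" for j
    by (rule sum_nonneg_0[rotated 2]) (use E0 that in auto)
  have "(\<Sum>j<n. G k j) = 0"
    by (rule sum_nonneg_0[OF _ _ G1]) (use G0 k(1) in \<open>auto intro: sum_nonneg\<close>)
  then have Gkj: "G k j = 0" if "j < n" for j
    by (rule sum_nonneg_0[rotated 2]) (use G0 k(1) that in auto)
  have full: "(\<Sum>j<n. (b k j)\<^sup>2) = N\<^sup>2" using Rk k(2) by (simp add: R_def)
  have "\<exists>j<n. b k j \<noteq> 0"
  proof (rule ccontr)
    assume "\<not> (\<exists>j<n. b k j \<noteq> 0)"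
    then have "(\<Sum>j<n. (b k j)\<^sup>2) = 0" by (intro sum.neutral) auto
    then show False using full N by simp
  qed
  then obtain j where j: "j < n" "b k j \<noteq> 0" by blast
  have tj: "t j = t k" using Ekj[OF j(1)] j(2) by (simp add: E_def)
  have "b k j ^ r = N ^ r" using Gkj[OF j(1)] j(2) tj k(2) by (simp add: G_def)
  then have bj: "b k j = N" using r N b0[OF k(1) j(1)] by (simp add: power_eq_iff_eq_base)
  have "(\<Sum>i\<in>{..<n} - {j}. (b k i)\<^sup>2) = 0"
    using full j(1) bj by (simp add: sum_diff1)
  then have "b k i = 0" if "i < n" "i \<noteq> j" for i
    using that by (simp add: sum_nonneg_eq_0_iff)
  then show ?thesis using that[of j] j(1) tj bj k(2) by simp
qed

section \<open>Cycles of weighted functional graphs\<close>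

lemma finite_self_map_has_cycle:
  fixes \<sigma> :: "'a \<Rightarrow> 'a"
  assumes fin: "finite S" and s: "s \<in> S" and maps: "\<And>k. k \<in> S \<Longrightarrow> \<sigma> k \<in> S"
  obtains p :: "nat \<Rightarrow> 'a" and L where "L > 0" "\<And>i. p i \<in> S" "\<And>i. p (Suc i) = \<sigma> (p i)"
    "inj_on p {..<L}" "p L = p 0"
proof -
  define q where "q i = (\<sigma> ^^ i) s" for i
  have qS: "q i \<in> S" for i by (induction i) (auto simp: q_def s maps)
  have q_Suc: "q (Suc i) = \<sigma> (q i)" for i by (simp add: q_def)
  define per where "per L \<longleftrightarrow> L > 0 \<and> (\<exists>i. q (i + L) = q i)" for L
  have "finite (range q)" using fin qS by (auto intro: finite_subset)
  then have "\<not> inj q" using finite_imageD infinite_UNIV_nat by blast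
  then obtain i j where ij: "i < j" "q i = q j" by (metis injI linorder_neqE_nat)
  then have "per (j - i)" by (auto simp: per_def intro!: exI[of _ i])
  \<comment> \<open>Minimality of the period makes a stretch of \<open>L\<close> consecutive orbit points injective.\<close>
  define L where "L = (LEAST L. per L)"
  have L: "per L" unfolding L_def by (rule LeastI) fact
  then obtain i0 where i0: "q (i0 + L) = q i0" and "L > 0" by (auto simp: per_def)
  show ?thesis
  proof (rule that[of L "\<lambda>i. q (i0 + i)"])
    show "inj_on (\<lambda>i. q (i0 + i)) {..<L}"
    proof (rule linorder_inj_onI')
      fix a c assume "a \<in> {..<L}" "c \<in> {..<L}" "a < c"
      then have "c - a < L" "0 < c - a" "(i0 + a) + (c - a) = i0 + c" by auto
      then have "\<not> per (c - a)" unfolding L_def using not_less_Least by blast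
      then have "q ((i0 + a) + (c - a)) \<noteq> q (i0 + a)"
        using \<open>0 < c - a\<close> unfolding per_def by blast
      then show "q (i0 + a) \<noteq> q (i0 + c)"
        unfolding \<open>(i0 + a) + (c - a) = i0 + c\<close> by (rule not_sym)
    qed
  qed (use \<open>L > 0\<close> i0 qS q_Suc in auto)
qed

lemma exists_nth_root:
  fixes z :: complex
  assumes "L > 0" "z \<noteq> 0"
  obtains w where "w ^ L = z"
proof -
  have "card {w. w ^ L = z} = L" using card_nth_roots[OF assms(2,1)] .
  then have "{w. w ^ L = z} \<noteq> {}" using assms(1) by (metis card.empty less_irrefl)
  then show ?thesis using that by blast
qed

text \<open>
  A cycle \<open>p 0, p 1, \<dots>\<close> of the map \<open>\<sigma>\<close> from a row to the column of its only nonzero entry carries an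
  eigenvector of a weighted cyclic shift. With weights \<open>w i\<close> the eigenvalue equation on the cycle is
  \<open>w i * y (p (i + 1)) = \<mu> * y (p i)\<close>; it closes up after \<open>L\<close> steps because \<open>\<mu>\<close> is an \<open>L\<close>-th root of
  the product of the weights. The equation may fail in rows off the cycle, but there \<open>y\<close> vanishes, so
  the quadratic form does not see them.
\<close>

lemma quadratic_form_on_cycle:
  fixes B :: "complex mat"
  assumes B: "B \<in> carrier_mat n n" and S: "S \<subseteq> {..<n}" "s \<in> S" and c: "c > 0"
    and \<sigma>: "\<And>k. k \<in> S \<Longrightarrow> \<sigma> k \<in> S"
    and entry: "\<And>k. k \<in> S \<Longrightarrow> cmod (B $$ (k, \<sigma> k)) = c"
    and zero: "\<And>k j. k \<in> S \<Longrightarrow> j < n \<Longrightarrow> j \<noteq> \<sigma> k \<Longrightarrow> B $$ (k, j) = 0"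
  obtains y \<mu> where "y \<in> carrier_vec n" "y \<noteq> 0\<^sub>v n" "cmod \<mu> = c"
    "(B *\<^sub>v y) \<bullet>c y = \<mu> * of_real ((l2_norm_vec y)\<^sup>2)"
proof -
  obtain p :: "nat \<Rightarrow> nat" and L where L: "L > 0" and pS: "\<And>i. p i \<in> S"
    and p_Suc: "\<And>i. p (Suc i) = \<sigma> (p i)" and inj: "inj_on p {..<L}" and pL: "p L = p 0"
    by (rule finite_self_map_has_cycle[OF finite_subset[OF S(1) finite_lessThan] S(2), of \<sigma>])
      (use \<sigma> in auto)
  have pn: "p i < n" for i using pS S(1) by blast
  define w where "w i = B $$ (p i, p (Suc i))" for i
  have cmod_w: "cmod (w i) = c" for i by (simp add: w_def p_Suc entry pS)
  then have w0: "w i \<noteq> 0" for i using c by (metis less_irrefl norm_zero)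
  obtain \<mu> where \<mu>: "\<mu> ^ L = (\<Prod>i<L. w i)"
    using exists_nth_root[OF L, of "\<Prod>i<L. w i"] w0 by auto
  have "cmod \<mu> ^ L = c ^ L" using arg_cong[OF \<mu>, of cmod]
    by (simp add: norm_power cmod_w prod_norm[symmetric])
  then have cmod_\<mu>: "cmod \<mu> = c" using L c by (simp add: power_eq_iff_eq_base)
  define g where "g i = \<mu> ^ i / (\<Prod>h<i. w h)" for i
  have g_step: "w i * g (Suc i) = \<mu> * g i" for i using w0 by (simp add: g_def)
  have gL: "g L = g 0" using w0 by (simp add: g_def \<mu>)
  define y where "y = vec n (\<lambda>j. if j \<in> p ` {..<L} then g (the_inv_into {..<L} p j) else 0)"
  have y: "y \<in> carrier_vec n" by (simp add: y_def)
  have yp: "y $ p i = g i" if "i < L" for i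
    using that pn by (simp add: y_def the_inv_into_f_f[OF inj])
  have yp': "y $ p (Suc i) = g (Suc i)" if "i < L" for i
    using that yp[of "Suc i"] yp[of 0] L gL pL by (cases "Suc i = L") auto
  have By: "(B *\<^sub>v y) $ j * cnj (y $ j) = \<mu> * (y $ j * cnj (y $ j))" if j: "j < n" for j
  proof (cases "j \<in> p ` {..<L}")
    case True
    then obtain i where i: "i < L" "j = p i" by auto
    have "(B *\<^sub>v y) $ p i = (\<Sum>l<n. if l = p (Suc i) then w i * y $ l else 0)"
      unfolding mult_mat_vec_nth[OF B y pn]
      by (intro sum.cong refl) (auto simp: w_def p_Suc zero pS)
    also have "\<dots> = \<mu> * y $ p i" using pn i by (simp add: yp yp' g_step)
    finally show ?thesis by (simp add: i)
  next
    case False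
    then show ?thesis using j by (simp add: y_def)
  qed
  show ?thesis
  proof (rule that[OF y _ cmod_\<mu>])
    have "y $ p 0 \<noteq> 0" using yp[OF L] by (simp add: g_def)
    then show "y \<noteq> 0\<^sub>v n" using pn by auto
    have "(B *\<^sub>v y) \<bullet>c y = (\<Sum>j<n. \<mu> * (y $ j * cnj (y $ j)))"
      unfolding inner_prod_sum[OF mult_mat_vec_carrier[OF B y] y]
      by (intro sum.cong refl By) auto
    also have "\<dots> = \<mu> * (y \<bullet>c y)"
      unfolding inner_prod_sum[OF y y] by (simp add: sum_distrib_left)
    finally show "(B *\<^sub>v y) \<bullet>c y = \<mu> * of_real ((l2_norm_vec y)\<^sup>2)"
      by (simp only: inner_prod_self[OF y])
  qed
qed

section \<open>Numerical radii of Hadamard powers\<close>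

text \<open>
  Reaching the bound \<open>\<parallel>A\<parallel>\<^sup>m \<noteq> 0\<close> leaves a single nonzero entry in certain rows of \<open>A\<close>, and raising
  all entries to another positive power preserves this shape. With \<open>m = 2\<close> the entries could be spread
  over a row, as in a real orthogonal matrix whose entries all have the same modulus.
\<close>

lemma hadamard_power_extremal_transfer:
  assumes n: "n \<ge> 1" and A: "A \<in> carrier_mat n n" and m: "m \<ge> 3" and m': "m' \<ge> 1"
    and ext: "numerical_radius (hadamard_power A m) = spectral_norm A ^ m"
  shows "numerical_radius (hadamard_power A m') = spectral_norm A ^ m'"
proof (rule antisym)
  let ?N = "spectral_norm A" and ?H = "hadamard_power A"
  have H: "?H i \<in> carrier_mat n n" for i using A by (simp add: hadamard_power_def)
  have H_nth: "?H i $$ (k, j) = A $$ (k, j) ^ i" if "k < n" "j < n" for i k j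
    using that A by (simp add: hadamard_power_def)
  show "numerical_radius (?H m') \<le> ?N ^ m'" by (rule numerical_radius_hadamard_power_le[OF n m' A])
  show "?N ^ m' \<le> numerical_radius (?H m')"
  proof (cases "?N = 0")
    case True
    then show ?thesis using m' numerical_radius_nonneg[OF n H[of m']] by (simp add: power_0_left)
  next
    case False
    then have N: "?N > 0" using spectral_norm_nonneg[OF n A] by simp
    obtain r where r: "r > 0" "m = r + 2" using m that[of "m - 2"] by auto
    obtain x where x: "x \<in> carrier_vec n" "l2_norm_vec x = 1"
      "numerical_radius (?H m) = cmod ((?H m *\<^sub>v x) \<bullet>c x)"
      using numerical_radius_attained[OF n H] by metis
    define b where "b k j = cmod (A $$ (k, j))" for k j
    define t where "t j = cmod (x $ j)" for j
    have t1: "(\<Sum>k<n. (t k)\<^sup>2) = 1" using l2_norm_vec_square[OF x(1)] x(2) by (simp add: t_def)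
    have "(?H m *\<^sub>v x) \<bullet>c x = (\<Sum>k<n. \<Sum>j<n. A $$ (k, j) ^ m * (x $ j * cnj (x $ k)))"
      unfolding inner_prod_sum[OF mult_mat_vec_carrier[OF H x(1)] x(1)]
      by (intro sum.cong refl) (simp add: mult_mat_vec_nth[OF H x(1)] H_nth sum_distrib_right
          mult.assoc del: index_mult_mat_vec)
    also have "cmod \<dots> \<le> (\<Sum>k<n. \<Sum>j<n. b k j ^ (r + 2) * (t j * t k))"
      by (intro sum_norm_le order_trans[OF norm_sum] sum_mono)
        (simp add: b_def t_def r norm_mult norm_power)
    finally have reach: "?N ^ (r + 2) \<le> (\<Sum>k<n. \<Sum>j<n. b k j ^ (r + 2) * (t j * t k))"
      using ext x(3) r(2) by simp
    define S where "S = {k. k < n \<and> t k > 0}"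
    have "\<exists>j. j \<in> S \<and> b k j = ?N \<and> (\<forall>i<n. i \<noteq> j \<longrightarrow> b k i = 0)" if "k \<in> S" for k
      using extremal_row_has_single_entry[of ?N r n b t k, OF N r(1) _ _ _ _ t1 reach]
        row_norm_le[OF n A] column_norm_le[OF n A] that
      unfolding b_def t_def S_def by (smt (verit) mem_Collect_eq norm_ge_zero)
    then obtain \<sigma> where \<sigma>: "\<And>k. k \<in> S \<Longrightarrow> \<sigma> k \<in> S" "\<And>k. k \<in> S \<Longrightarrow> b k (\<sigma> k) = ?N"
      "\<And>k i. k \<in> S \<Longrightarrow> i < n \<Longrightarrow> i \<noteq> \<sigma> k \<Longrightarrow> b k i = 0"
      by metis
    have Sn: "S \<subseteq> {..<n}" by (auto simp: S_def)
    have "\<exists>s. s \<in> S"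
    proof (rule ccontr)
      assume "\<nexists>s. s \<in> S"
      then have "t k = 0" if "k < n" for k using that by (auto simp: S_def t_def)
      then show False using t1 by simp
    qed
    then obtain s where s: "s \<in> S" by blast
    have entry: "cmod (?H m' $$ (k, \<sigma> k)) = ?N ^ m'" if "k \<in> S" for k
      using that \<sigma>(1,2)[OF that] Sn by (subst H_nth) (auto simp: norm_power b_def)
    have zero: "?H m' $$ (k, j) = 0" if "k \<in> S" "j < n" "j \<noteq> \<sigma> k" for k j
      using that \<sigma>(3)[OF that] Sn m' by (subst H_nth) (auto simp: b_def)
    obtain y \<mu> where y: "y \<in> carrier_vec n" "y \<noteq> 0\<^sub>v n" "cmod \<mu> = ?N ^ m'"
      "(?H m' *\<^sub>v y) \<bullet>c y = \<mu> * of_real ((l2_norm_vec y)\<^sup>2)"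
      by (rule quadratic_form_on_cycle[OF H[of m'] Sn s zero_less_power[OF N, of m'], of \<sigma>])
        (use \<sigma>(1) entry zero in blast)+
    have "l2_norm_vec y \<noteq> 0" using y l2_norm_vec_eq_0_iff by blast
    moreover have "?N ^ m' * (l2_norm_vec y)\<^sup>2 \<le> numerical_radius (?H m') * (l2_norm_vec y)\<^sup>2"
      using quadratic_form_le[OF n H y(1), of m'] y(3,4) by (simp add: norm_mult norm_power)
    ultimately show ?thesis by simp
  qed
qed

lemma hadamard_power_1: "hadamard_power A 1 = A"
  by (auto simp: hadamard_power_def)

text \<open>
  Both directions compare the forms of the two powers at corresponding vectors: a maximiser for the
  Hadamard power, extended to a diagonal tensor, is a Cauchy--Schwarz equality case for the Kronecker
  power, and a diagonal eigenvector, restricted to the diagonal, is a test vector for the Hadamard power.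
\<close>

lemma hadamard_power_extremal_iff:
  assumes n: "n \<ge> 1" and m: "m \<ge> 1" and A: "A \<in> carrier_mat n n"
  shows "numerical_radius (hadamard_power A m) = spectral_norm A ^ m \<longleftrightarrow>
    (\<exists>v lam. eigenvector (kronecker_mat_power A m) v lam \<and>
       v \<in> span_vec (n ^ m) ((\<lambda>j. kronecker_vec_power (unit_vec n j) m) ` {..<n}) \<and>
       cmod lam = spectral_norm A ^ m)"
    (is "?extremal \<longleftrightarrow> ?eigen")
proof -
  let ?M = "kronecker_mat_power A m" and ?H = "hadamard_power A m" and ?D = "diag_index n m ` {..<n}"
  have M: "?M \<in> carrier_mat (n ^ m) (n ^ m)" by (rule kronecker_mat_power_carrier[OF A])
  have H: "?H \<in> carrier_mat n n" using A by (simp add: hadamard_power_def)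
  have "(\<lambda>j. kronecker_vec_power (unit_vec n j) m) ` {..<n} = unit_vec (n ^ m) ` ?D"
    unfolding image_image by (intro image_cong) (auto simp: kronecker_vec_power_unit_vec)
  moreover have "?D \<subseteq> {..<n ^ m}" by (auto simp: diag_index_less)
  ultimately have span: "span_vec (n ^ m) ((\<lambda>j. kronecker_vec_power (unit_vec n j) m) ` {..<n}) =
      {v \<in> carrier_vec (n ^ m). \<forall>i<n ^ m. i \<notin> ?D \<longrightarrow> v $ i = 0}"
    by (simp only: span_unit_vecs_subset)
  show ?thesis
  proof
    assume ext: ?extremal
    obtain x where x: "x \<in> carrier_vec n" "l2_norm_vec x = 1"
      "numerical_radius ?H = cmod ((?H *\<^sub>v x) \<bullet>c x)"
      using numerical_radius_attained[OF n H] by metis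
    obtain v where v: "v \<in> carrier_vec (n ^ m)" "\<And>i. i < n ^ m \<Longrightarrow> i \<notin> ?D \<Longrightarrow> v $ i = 0"
      "vec n (\<lambda>j. v $ diag_index n m j) = x"
      using obtain_diag_supported[OF m x(1)] by metis
    define lam where "lam = (?M *\<^sub>v v) \<bullet>c v"
    have v1: "l2_norm_vec v = 1" using diag_supported_norm[OF m v(1,2)] v(3) x(2) by simp
    have lam: "cmod lam = spectral_norm A ^ m"
      using hadamard_power_compression[OF m A v(1,2)] v(3) x(3) ext by (simp add: lam_def)
    have "l2_norm_vec (?M *\<^sub>v v) \<le> cmod lam"
      using l2_norm_kronecker_mat_power_le[OF n A v(1)] v1 lam by simp
    then have "?M *\<^sub>v v = lam \<cdot>\<^sub>v v"
      unfolding lam_def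
      by (rule eq_smult_if_inner_prod_extremal[OF mult_mat_vec_carrier[OF M v(1)] v(1) v1])
    moreover have "v \<noteq> 0\<^sub>v (n ^ m)" using v1 l2_norm_vec_eq_0_iff[OF v(1)] by auto
    ultimately have "eigenvector ?M v lam" using M v(1) by (auto simp: eigenvector_def)
    then show ?eigen using v lam unfolding span by blast
  next
    assume ?eigen
    then obtain v lam where "eigenvector ?M v lam" and lam: "cmod lam = spectral_norm A ^ m"
      and supp: "\<And>i. i < n ^ m \<Longrightarrow> i \<notin> ?D \<Longrightarrow> v $ i = 0"
      unfolding span by blast
    then have v: "v \<in> carrier_vec (n ^ m)" "v \<noteq> 0\<^sub>v (n ^ m)" "?M *\<^sub>v v = lam \<cdot>\<^sub>v v"
      using M by (auto simp: eigenvector_def)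
    define x where "x = vec n (\<lambda>j. v $ diag_index n m j)"
    have x: "x \<in> carrier_vec n" by (simp add: x_def)
    have norm_x: "l2_norm_vec x = l2_norm_vec v"
      unfolding x_def by (rule diag_supported_norm[OF m v(1) supp])
    have "(?H *\<^sub>v x) \<bullet>c x = (lam \<cdot>\<^sub>v v) \<bullet>c v"
      using hadamard_power_compression[OF m A v(1) supp] v(3) by (simp add: x_def)
    also have "\<dots> = lam * of_real ((l2_norm_vec v)\<^sup>2)"
      using v(1) inner_prod_self[OF v(1)] by simp
    finally have "cmod ((?H *\<^sub>v x) \<bullet>c x) = spectral_norm A ^ m * (l2_norm_vec v)\<^sup>2"
      by (simp add: norm_mult norm_power lam)
    then have "spectral_norm A ^ m * (l2_norm_vec v)\<^sup>2 \<le> numerical_radius ?H * (l2_norm_vec v)\<^sup>2"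
      using quadratic_form_le[OF n H x] norm_x by simp
    moreover have "l2_norm_vec v \<noteq> 0" using v l2_norm_vec_eq_0_iff by blast
    ultimately have "spectral_norm A ^ m \<le> numerical_radius ?H" by simp
    then show ?extremal using numerical_radius_hadamard_power_le[OF n m A] by simp
  qed
qed

theorem theorem1p5:
  fixes A :: "complex mat" and n m :: nat
  assumes "n \<ge> 1"
    and "A \<in> carrier_mat n n"
    and "numerical_radius A = spectral_norm A"
    and "m \<ge> 1"
  shows "(numerical_radius (hadamard_power A m) = numerical_radius A ^ m \<longleftrightarrow>
      (\<exists>v lam. eigenvector (kronecker_mat_power A m) v lam \<and>
         v \<in> span_vec (n ^ m) ((\<lambda>j. kronecker_vec_power (unit_vec n j) m) ` {..<n}) \<and>
         cmod lam = spectral_norm A ^ m)) \<and>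
    (numerical_radius (hadamard_power A m) = numerical_radius A ^ m \<longrightarrow>
      (\<forall>m'. 1 \<le> m' \<and> m' \<le> m \<longrightarrow>
         numerical_radius (hadamard_power A m') = numerical_radius A ^ m'))"
proof (intro conjI impI allI)
  let ?w = "\<lambda>i. numerical_radius (hadamard_power A i)"
  show "?w m = numerical_radius A ^ m \<longleftrightarrow>
      (\<exists>v lam. eigenvector (kronecker_mat_power A m) v lam \<and>
         v \<in> span_vec (n ^ m) ((\<lambda>j. kronecker_vec_power (unit_vec n j) m) ` {..<n}) \<and>
         cmod lam = spectral_norm A ^ m)"
    unfolding assms(3) by (rule hadamard_power_extremal_iff[OF assms(1,4,2)])
  fix m' assume ext: "?w m = numerical_radius A ^ m" and m': "1 \<le> m' \<and> m' \<le> m"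
  consider "m' = 1" | "m' = m" | "m \<ge> 3" using m' by linarith
  then show "?w m' = numerical_radius A ^ m'"
  proof cases
    case 1
    then show ?thesis by (simp only: hadamard_power_1 power_one_right)
  next
    case 2
    then show ?thesis using ext by simp
  next
    case 3
    then show ?thesis
      using hadamard_power_extremal_transfer[OF assms(1,2) 3] m' ext assms(3) by simp
  qed
qed

end
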